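(* Let $\mathcal{G}$ be an equationally Noetherian family of groups, and let $L$ be a $\mathcal{G}$-limit group. Then $L$ is equationally Noetherian. Moreover, if all the groups in $\mathcal{G}$ are finite, then $L$ is residually finite.
   Context: For $n \geq 1$ let $F_n$ be the free group with free basis $X_1,\ldots,X_n$. For a group $G$, $s \in F_n$ and $(g_1,\ldots,g_n) \in G^n$, $s(g_1,\ldots,g_n) \in G$ is the image of $s$ under the homomorphism $F_n \to G$, $X_i \mapsto g_i$. For $S \subseteq F_n$ put $V_G(S) = \{ (g_1,\ldots,g_n) \in G^n \mid s(g_1,\ldots,g_n) = 1 \text{ for all } s \in S \}$. A group $G$ is equationally Noetherian if for every $n \geq 1$ and every $S \subseteq F_n$ there is a finite subset $S_0 \subseteq S$ with $V_G(S_0) = V_G(S)$. A family $\mathcal{G}$ of groups is an equationally Noetherian family if for every $n \geq 1$ and every $S \subseteq F_n$ there is a finite subset $S_0 \subseteq S$ such that $V_G(S_0) = V_G(S)$ for all $G \in \mathcal{G}$ simultaneously. An ultrafilter on $\mathbb{N}$ is a finitely additive probability measure $\omega: 2^{\mathbb{N}} \to \{0,1\}$; it is non-principal if $\omega(F)=0$ for every finite $F \subset \mathbb{N}$. A non-principal ultrafilter $\omega$ is fixed throughout. A sequence of statements $(P_j)_{j \in \mathbb{N}}$ holds $\omega$-almost surely if $\omega(\{ j \in \mathbb{N} \mid P_j \text{ holds}\}) = 1$. For a group $G$ and a sequence of homomorphisms $\varphi_j: G \to H_j$ with $H_j \in \mathcal{G}$ ($j \in \mathbb{N}$), put $\ker^\omega(\varphi_j)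 = \{ g \in G \mid \varphi_j(g) = 1 \ \omega\text{-almost surely} \}$, a normal subgroup of $G$. A $\mathcal{G}$-limit group is a group of the form $G/\ker^\omega(\varphi_j)$, where $G$ is a finitely generated group and $(\varphi_j)_{j\in\mathbb{N}}$ is such a sequence of homomorphisms. *)

theory Defs
  imports Complex_Main "HOL-Algebra.Coset" "HOL-Algebra.Generated_Groups"
begin

section \<open>Free groups\<close>

text \<open>
  The free group on a set is modelled by reduced words. The letter \<^term>\<open>(x, True)\<close> stands for the
  basis element \<^term>\<open>x\<close>, and \<^term>\<open>(x, False)\<close> for its inverse.
\<close>

type_synonym 'x word = "('x \<times> bool) list"

definition inv_letter :: "'x \<times> bool \<Rightarrow> 'x \<times> bool" where
  "inv_letter a = (fst a, \<not> snd a)"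

fun reduced :: "'x word \<Rightarrow> bool" where
  "reduced (a # b # w) \<longleftrightarrow> b \<noteq> inv_letter a \<and> reduced (b # w)"
| "reduced _ \<longleftrightarrow> True"

text \<open>The reduced form of \<^term>\<open>a # w\<close>, for a reduced word \<^term>\<open>w\<close>.\<close>

fun cons_red :: "'x \<times> bool \<Rightarrow> 'x word \<Rightarrow> 'x word" where
  "cons_red a [] = [a]"
| "cons_red a (b # w) = (if b = inv_letter a then w else a # b # w)"

definition free_group :: "'x set \<Rightarrow> 'x word monoid" where
  "free_group X =
    \<lparr>carrier = {w. reduced w \<and> fst ` set w \<subseteq> X}, mult = foldr cons_red, one = []\<rparr>"

definition free_gen :: "'x \<Rightarrow> 'x word" where
  "free_gen x = [(x, True)]"

lemma inv_letter_inv_letter [simp]: "inv_letter (inv_letter a) = a"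
  by (simp add: inv_letter_def)

lemma inv_letter_neq [simp]: "inv_letter a \<noteq> a" "a \<noteq> inv_letter a"
  by (cases a; simp add: inv_letter_def)+

lemma fst_inv_letter [simp]: "fst (inv_letter a) = fst a"
  by (simp add: inv_letter_def)

lemma reduced_ConsD: "reduced (a # w) \<Longrightarrow> reduced w"
  by (cases w) auto

lemma reduced_cons_red: "reduced w \<Longrightarrow> reduced (cons_red a w)"
  by (cases w) (auto dest: reduced_ConsD)

lemma cons_red_reduced: "reduced (a # w) \<Longrightarrow> cons_red a w = a # w"
  by (cases w) auto

lemma cons_red_cancel:
  assumes "reduced w"
  shows "cons_red a (cons_red (inv_letter a) w) = w"
  using assms by (cases w rule: reduced.cases) auto

lemma reduced_foldr: "reduced v \<Longrightarrow> reduced (foldr cons_red u v)"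
  by (induction u) (auto intro: reduced_cons_red)

lemma set_cons_red: "set (cons_red a w) \<subseteq> insert a (set w)"
  by (cases w) auto

lemma set_foldr_cons_red: "set (foldr cons_red u v) \<subseteq> set u \<union> set v"
proof (induction u)
  case (Cons a u)
  then show ?case using set_cons_red[of a "foldr cons_red u v"] by auto
qed auto

lemma foldr_cons_red_step:
  assumes "reduced v"
  shows "foldr cons_red (cons_red a u) v = cons_red a (foldr cons_red u v)"
proof (cases u)
  case (Cons b u')
  show ?thesis
    using cons_red_cancel[OF reduced_foldr[OF assms], of a u'] Cons by auto
qed simp

lemma foldr_cons_red_assoc:
  assumes "reduced w"
  shows "foldr cons_red (foldr cons_red u v) w = foldr cons_red u (foldr cons_red v w)"
  by (induction u) (simp_all add: foldr_cons_red_step assms)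

lemma foldr_cons_red_Nil: "reduced w \<Longrightarrow> foldr cons_red w [] = w"
proof (induction w)
  case (Cons a w)
  then have "reduced w" by (rule_tac reduced_ConsD)
  with Cons show ?case by (simp add: cons_red_reduced)
qed simp

lemma foldr_cons_red_inv:
  "reduced v \<Longrightarrow> foldr cons_red (rev (map inv_letter u)) (foldr cons_red u v) = v"
proof (induction u arbitrary: v)
  case (Cons a u)
  then show ?case
    using cons_red_cancel[OF reduced_foldr[OF Cons.prems], of "inv_letter a" u] by simp
qed simp

lemma reduced_inverse_exists:
  assumes "reduced w"
  shows "\<exists>v. reduced v \<and> set v \<subseteq> inv_letter ` set w \<and> foldr cons_red v w = []"
proof -
  define u where "u = rev (map inv_letter w)"
  define v where "v = foldr cons_red u []"
  have "foldr cons_red v w = foldr cons_red u w"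
    using foldr_cons_red_assoc[OF assms, of u "[]"] by (simp add: v_def)
  also have "\<dots> = []"
    using foldr_cons_red_inv[of "[]" w] assms by (simp add: u_def foldr_cons_red_Nil)
  finally have "foldr cons_red v w = []" .
  moreover have "set v \<subseteq> inv_letter ` set w"
    using set_foldr_cons_red[of u "[]"] by (auto simp: v_def u_def)
  moreover have "reduced v" by (simp add: v_def reduced_foldr)
  ultimately show ?thesis by blast
qed

lemma group_free_group: "group (free_group X)"
proof (rule groupI)
  fix u v assume "u \<in> carrier (free_group X)" "v \<in> carrier (free_group X)"
  then show "u \<otimes>\<^bsub>free_group X\<^esub> v \<in> carrier (free_group X)"
    using set_foldr_cons_red[of u v] by (fastforce simp: free_group_def reduced_foldr)
next
  fix u assume u: "u \<in> carrier (free_group X)"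
  then obtain v where "reduced v" "set v \<subseteq> inv_letter ` set u" "foldr cons_red v u = []"
    using reduced_inverse_exists[of u] by (auto simp: free_group_def)
  with u have "v \<in> carrier (free_group X)" "v \<otimes>\<^bsub>free_group X\<^esub> u = \<one>\<^bsub>free_group X\<^esub>"
    by (fastforce simp: free_group_def)+
  then show "\<exists>v\<in>carrier (free_group X). v \<otimes>\<^bsub>free_group X\<^esub> u = \<one>\<^bsub>free_group X\<^esub>" by blast
qed (auto simp: free_group_def foldr_cons_red_assoc)

lemma free_gen_closed: "x \<in> X \<Longrightarrow> free_gen x \<in> carrier (free_group X)"
  by (simp add: free_gen_def free_group_def)

primrec eval_word :: "('a, 'm) monoid_scheme \<Rightarrow> ('x \<Rightarrow> 'a) \<Rightarrow> 'x word \<Rightarrow> 'a" where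
  "eval_word G g [] = \<one>\<^bsub>G\<^esub>"
| "eval_word G g (a # w) =
    (if snd a then g (fst a) else inv\<^bsub>G\<^esub> g (fst a)) \<otimes>\<^bsub>G\<^esub> eval_word G g w"

context group
begin

lemma eval_word_closed:
  assumes "g \<in> X \<rightarrow> carrier G" "fst ` set w \<subseteq> X"
  shows "eval_word G g w \<in> carrier G"
  using assms(2) by (induction w) (use assms(1) in auto)

lemma eval_word_cons_red:
  assumes "g \<in> X \<rightarrow> carrier G" "fst a \<in> X" "fst ` set w \<subseteq> X"
  shows "eval_word G g (cons_red a w) = eval_word G g (a # w)"
proof (cases w)
  case (Cons b v)
  have "g (fst a) \<in> carrier G" "eval_word G g v \<in> carrier G"
    using assms Cons eval_word_closed[of g X v] by auto
  then show ?thesis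
    using Cons by (auto simp: inv_letter_def m_assoc[symmetric])
qed simp

lemma eval_word_foldr:
  assumes "g \<in> X \<rightarrow> carrier G" "fst ` set u \<subseteq> X" "fst ` set v \<subseteq> X"
  shows "eval_word G g (foldr cons_red u v) = eval_word G g u \<otimes> eval_word G g v"
  using assms(2)
proof (induction u)
  case Nil
  then show ?case using eval_word_closed[OF assms(1,3)] by simp
next
  case (Cons a u)
  have "fst ` set (foldr cons_red u v) \<subseteq> X"
    using set_foldr_cons_red[of u v] Cons.prems assms(3) by fastforce
  moreover have "g (fst a) \<in> carrier G" "eval_word G g u \<in> carrier G" "eval_word G g v \<in> carrier G"
    using assms Cons.prems eval_word_closed[OF assms(1)] by auto
  ultimately show ?case
    using Cons eval_word_cons_red[OF assms(1), of a "foldr cons_red u v"] by (simp add: m_assoc)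
qed

lemma eval_word_hom:
  assumes "g \<in> X \<rightarrow> carrier G"
  shows "eval_word G g \<in> hom (free_group X) G"
  by (rule homI) (auto simp: free_group_def assms eval_word_closed[OF assms] eval_word_foldr[OF assms])

lemma eval_word_free_gen:
  assumes "g \<in> X \<rightarrow> carrier G" "x \<in> X"
  shows "eval_word G g (free_gen x) = g x"
  using assms by (auto simp: free_gen_def Pi_iff)

lemma free_group_hom_unique:
  assumes "h \<in> hom (free_group X) G" "\<And>x. x \<in> X \<Longrightarrow> h (free_gen x) = g x"
    and "w \<in> carrier (free_group X)"
  shows "h w = eval_word G g w"
proof -
  interpret F: group "free_group X" by (rule group_free_group)
  interpret group_hom "free_group X" G h
    using assms(1) by unfold_locales
  have letter: "h [a] = (if snd a then g (fst a) else inv g (fst a))" if "fst a \<in> X" for a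
  proof (cases "snd a")
    case True
    then have "[a] = free_gen (fst a)" by (cases a) (simp add: free_gen_def)
    then show ?thesis using True assms(2) that by simp
  next
    case False
    have c: "[a] \<in> carrier (free_group X)"
      using that by (simp add: free_group_def)
    have "[a] \<otimes>\<^bsub>free_group X\<^esub> free_gen (fst a) = \<one>\<^bsub>free_group X\<^esub>"
      using False by (cases a) (simp add: free_gen_def free_group_def inv_letter_def)
    then have "[a] = inv\<^bsub>free_group X\<^esub> free_gen (fst a)"
      using c free_gen_closed[OF that] by (simp add: F.inv_equality)
    then show ?thesis using False assms(2) that free_gen_closed[OF that] by simp
  qed
  show ?thesis using assms(3)
  proof (induction w)
    case Nil
    then show ?case using hom_one by (simp add: free_group_def)
  next
    case (Cons a w)
    then have w: "w \<in> carrier (free_group X)" and a: "fst a \<in> X" and r: "reduced (a # w)"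
      by (auto simp: free_group_def dest: reduced_ConsD)
    then have "a # w = [a] \<otimes>\<^bsub>free_group X\<^esub> w"
      by (simp add: free_group_def cons_red_reduced)
    then have "h (a # w) = h [a] \<otimes> h w"
      using w a hom_mult[of "[a]" w] by (simp add: free_group_def)
    then show ?case using Cons.IH[OF w] letter[OF a] by simp
  qed
qed

end


section \<open>Equations over groups\<close>

text \<open>
  The value of \<open>s\<close> at \<open>(g 1, \<dots>, g n)\<close>: the image of \<open>s\<close> under the homomorphism from the
  free group on \<open>{1..n}\<close> to \<open>G\<close> that sends the \<open>i\<close>-th basis element to \<open>g i\<close>. The next lemma
  shows that it is well defined.
\<close>

definition subst_val :: "('a, 'm) monoid_scheme \<Rightarrow> nat \<Rightarrow> (nat \<Rightarrow> 'a) \<Rightarrow> nat word \<Rightarrow> 'a" where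
  "subst_val G n g s =
    (THE y. \<exists>h\<in>hom (free_group {1..n}) G. (\<forall>i\<in>{1..n}. h (free_gen i) = g i) \<and> h s = y)"

lemma (in group) subst_val_eq_eval_word:
  assumes "g \<in> {1..n} \<rightarrow> carrier G" "s \<in> carrier (free_group {1..n})"
  shows "subst_val G n g s = eval_word G g s"
  unfolding subst_val_def
proof (rule the_equality)
  show "\<exists>h\<in>hom (free_group {1..n}) G. (\<forall>i\<in>{1..n}. h (free_gen i) = g i) \<and> h s = eval_word G g s"
    using eval_word_hom[OF assms(1)] eval_word_free_gen[OF assms(1)] by blast
next
  fix y
  assume "\<exists>h\<in>hom (free_group {1..n}) G. (\<forall>i\<in>{1..n}. h (free_gen i) = g i) \<and> h s = y"
  then show "y = eval_word G g s"
    using free_group_hom_unique[OF _ _ assms(2)] by blast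
qed

definition solution_set :: "('a, 'm) monoid_scheme \<Rightarrow> nat \<Rightarrow> nat word set \<Rightarrow> (nat \<Rightarrow> 'a) set" where
  "solution_set G n S =
    {g \<in> {1..n} \<rightarrow>\<^sub>E carrier G. \<forall>s\<in>S. subst_val G n g s = \<one>\<^bsub>G\<^esub>}"

definition equationally_noetherian :: "('a, 'm) monoid_scheme \<Rightarrow> bool" where
  "equationally_noetherian G \<longleftrightarrow> group G \<and>
    (\<forall>n\<ge>1. \<forall>S\<subseteq>carrier (free_group {1..n}).
      \<exists>S0\<subseteq>S. finite S0 \<and> solution_set G n S0 = solution_set G n S)"

definition equationally_noetherian_family :: "('a, 'm) monoid_scheme set \<Rightarrow> bool" where
  "equationally_noetherian_family \<G> \<longleftrightarrow> (\<forall>G\<in>\<G>. group G) \<and>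
    (\<forall>n\<ge>1. \<forall>S\<subseteq>carrier (free_group {1..n}).
      \<exists>S0\<subseteq>S. finite S0 \<and> (\<forall>G\<in>\<G>. solution_set G n S0 = solution_set G n S))"


section \<open>Ultrafilters and limit groups\<close>

definition ultrafilter :: "(nat set \<Rightarrow> real) \<Rightarrow> bool" where
  "ultrafilter \<omega> \<longleftrightarrow> (\<forall>A. \<omega> A \<in> {0, 1}) \<and> \<omega> UNIV = 1 \<and>
    (\<forall>A B. A \<inter> B = {} \<longrightarrow> \<omega> (A \<union> B) = \<omega> A + \<omega> B)"

definition nonprincipal_ultrafilter :: "(nat set \<Rightarrow> real) \<Rightarrow> bool" where
  "nonprincipal_ultrafilter \<omega> \<longleftrightarrow> ultrafilter \<omega> \<and> (\<forall>F. finite F \<longrightarrow> \<omega> F = 0)"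

definition almost_surely :: "(nat set \<Rightarrow> real) \<Rightarrow> (nat \<Rightarrow> bool) \<Rightarrow> bool" where
  "almost_surely \<omega> P \<longleftrightarrow> \<omega> {j. P j} = 1"

definition omega_kernel ::
  "(nat set \<Rightarrow> real) \<Rightarrow> ('b, 'k) monoid_scheme \<Rightarrow> (nat \<Rightarrow> ('a, 'm) monoid_scheme) \<Rightarrow>
    (nat \<Rightarrow> 'b \<Rightarrow> 'a) \<Rightarrow> 'b set" where
  "omega_kernel \<omega> G H \<phi> = {g \<in> carrier G. almost_surely \<omega> (\<lambda>j. \<phi> j g = \<one>\<^bsub>H j\<^esub>)}"

definition finitely_generated :: "('b, 'k) monoid_scheme \<Rightarrow> bool" where
  "finitely_generated G \<longleftrightarrow> (\<exists>A\<subseteq>carrier G. finite A \<and> generate G A = carrier G)"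

text \<open>
  The type argument is the type carrying the finitely generated group \<open>G\<close>; it has to appear as a
  parameter because \<open>G\<close> is existentially quantified. Limit groups are taken up to isomorphism;
  \<^term>\<open>group L\<close> is needed because the relation \<open>\<cong>\<close> ignores the \<^const>\<open>one\<close> field of the record.
\<close>

definition limit_group ::
  "'b itself \<Rightarrow> (nat set \<Rightarrow> real) \<Rightarrow> ('a, 'm) monoid_scheme set \<Rightarrow> ('c, 'l) monoid_scheme \<Rightarrow> bool" where
  "limit_group _ \<omega> \<G> L \<longleftrightarrow> group L \<and>
    (\<exists>(G :: 'b monoid) H \<phi>. group G \<and> finitely_generated G \<and>
      (\<forall>j. H j \<in> \<G> \<and> \<phi> j \<in> hom G (H j)) \<and>
      L \<cong> G Mod omega_kernel \<omega> G H \<phi>)"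

definition residually_finite :: "('a, 'm) monoid_scheme \<Rightarrow> bool" where
  "residually_finite G \<longleftrightarrow> group G \<and>
    (\<forall>g\<in>carrier G. g \<noteq> \<one>\<^bsub>G\<^esub> \<longrightarrow> (\<exists>N. N \<lhd> G \<and> finite (carrier (G Mod N)) \<and> g \<notin> N))"

end

(*
  For a system S over an equationally Noetherian family, let S0 be an equivalent finite subsystem.
  Omega-almost sure statements are closed under finite conjunctions only, but S0 is finite: if every
  equation of S0 holds almost surely along a sequence of tuples, then almost surely all of S0 holds
  at once, hence all of S at once. Applied to the images of a lift to G of a tuple of L, this shows
  that S0 and S have the same solutions in L. Applied to the system of all relations of L among
  generators of G, it shows that phi_j almost surely factors through L. For finite H_j, such a
  factorization that does not kill a given nontrivial element gives residual finiteness.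
*)
theory Submission
  imports Defs
begin

section \<open>Ultrafilters and almost sure statements\<close>

lemma ultrafilter_01: "ultrafilter \<omega> \<Longrightarrow> \<omega> A = 0 \<or> \<omega> A = 1"
  by (auto simp: ultrafilter_def)

lemma ultrafilter_disjoint_Un: "ultrafilter \<omega> \<Longrightarrow> A \<inter> B = {} \<Longrightarrow> \<omega> (A \<union> B) = \<omega> A + \<omega> B"
  by (simp add: ultrafilter_def)

lemma ultrafilter_Compl:
  assumes "ultrafilter \<omega>"
  shows "\<omega> (- A) = 1 - \<omega> A"
  using ultrafilter_disjoint_Un[OF assms, of A "- A"] assms by (simp add: ultrafilter_def)

lemma ultrafilter_mono:
  assumes "ultrafilter \<omega>" "A \<subseteq> B"
  shows "\<omega> A \<le> \<omega> B"
proof -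
  have "A \<union> (B - A) = B" using assms(2) by blast
  then have "\<omega> B = \<omega> A + \<omega> (B - A)"
    using ultrafilter_disjoint_Un[OF assms(1), of A "B - A"] by simp
  then show ?thesis using ultrafilter_01[OF assms(1), of "B - A"] by auto
qed

lemma almost_surely_True: "ultrafilter \<omega> \<Longrightarrow> almost_surely \<omega> (\<lambda>_. True)"
  by (simp add: almost_surely_def ultrafilter_def)

lemma almost_surely_mono:
  assumes "ultrafilter \<omega>" "almost_surely \<omega> P" "\<And>j. P j \<Longrightarrow> Q j"
  shows "almost_surely \<omega> Q"
proof -
  have "\<omega> {j. P j} \<le> \<omega> {j. Q j}"
    using assms(3) by (intro ultrafilter_mono[OF assms(1)]) auto
  then show ?thesis
    using assms(2) ultrafilter_01[OF assms(1), of "{j. Q j}"] by (auto simp: almost_surely_def)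
qed

text \<open>Of a set and its complement exactly one has measure 1. This turns the failure of an
  almost sure statement into an almost sure statement, which is how a nontrivial element of
  \<open>L\<close> acquires almost surely nontrivial images in the groups
  \<open>H j\<close>.\<close>

lemma almost_surely_not:
  assumes "ultrafilter \<omega>"
  shows "almost_surely \<omega> (\<lambda>j. \<not> P j) \<longleftrightarrow> \<not> almost_surely \<omega> P"
proof -
  have "{j. \<not> P j} = - {j. P j}" by auto
  then show ?thesis
    using ultrafilter_Compl[OF assms, of "{j. P j}"] ultrafilter_01[OF assms, of "{j. P j}"]
    by (auto simp: almost_surely_def)
qed

lemma almost_surely_conj:
  assumes "ultrafilter \<omega>" "almost_surely \<omega> P" "almost_surely \<omega> Q"
  shows "almost_surely \<omega> (\<lambda>j. P j \<and> Q j)"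
proof -
  let ?A = "{j. P j}" and ?B = "{j. Q j}"
  \<comment> \<open>Split \<open>?A\<close> along \<open>?B\<close>: the part outside
    \<open>?B\<close> lies in a null set, so the whole mass of \<open>?A\<close> sits in the
    intersection.\<close>
  have "\<omega> (?A \<inter> ?B \<union> (?A - ?B)) = \<omega> (?A \<inter> ?B) + \<omega> (?A - ?B)"
    by (rule ultrafilter_disjoint_Un[OF assms(1)]) blast
  moreover have "?A \<inter> ?B \<union> (?A - ?B) = ?A" by blast
  moreover have "\<omega> (?A - ?B) \<le> \<omega> (- ?B)" by (rule ultrafilter_mono[OF assms(1)]) blast
  moreover have "\<omega> (- ?B) = 0"
    using assms(3) ultrafilter_Compl[OF assms(1), of ?B] by (simp add: almost_surely_def)
  ultimately have "\<omega> (?A \<inter> ?B) = 1"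
    using assms(2) ultrafilter_01[OF assms(1), of "?A - ?B"] by (auto simp: almost_surely_def)
  then show ?thesis by (simp add: almost_surely_def Collect_conj_eq)
qed

lemma almost_surely_finite_Ball:
  assumes "ultrafilter \<omega>" "finite I" "\<And>i. i \<in> I \<Longrightarrow> almost_surely \<omega> (P i)"
  shows "almost_surely \<omega> (\<lambda>j. \<forall>i\<in>I. P i j)"
  using assms(2,3)
proof (induction I)
  case empty
  then show ?case using almost_surely_True[OF assms(1)] by simp
next
  case (insert i I)
  then show ?case
    using almost_surely_conj[OF assms(1), of "P i" "\<lambda>j. \<forall>i\<in>I. P i j"] by simp
qed

text \<open>Otherwise the negation of \<open>P\<close> would hold everywhere, hence almost
  surely.\<close>

lemma almost_surely_imp_ex: "ultrafilter \<omega> \<Longrightarrow> almost_surely \<omega> P \<Longrightarrow> \<exists>j. P j"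
  using almost_surely_not[of \<omega> P] almost_surely_mono[of \<omega> "\<lambda>_. True" "\<lambda>j. \<not> P j"]
    almost_surely_True[of \<omega>] by blast

section \<open>Limit groups as quotients by the omega-kernel\<close>

text \<open>Each closure property holds for every index \<open>j\<close> separately. Inverses and
  conjugates then follow by monotonicity of almost sure statements; products combine two such
  statements by conjunction.\<close>

lemma omega_kernel_normal:
  assumes \<omega>: "ultrafilter \<omega>" and "group G"
    and hom: "\<And>j. group_hom G (H j) (\<phi> j)"
  shows "omega_kernel \<omega> G H \<phi> \<lhd> G"
proof -
  interpret G: group G by fact
  have one: "\<phi> j \<one>\<^bsub>G\<^esub> = \<one>\<^bsub>H j\<^esub>" for j
    by (rule group_hom.hom_one[OF hom])
  have m: "\<phi> j (x \<otimes>\<^bsub>G\<^esub> y) = \<phi> j x \<otimes>\<^bsub>H j\<^esub> \<phi> j y" if "x \<in> carrier G" "y \<in> carrier G" for j x y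
    using that by (rule group_hom.hom_mult[OF hom])
  have i: "\<phi> j (inv\<^bsub>G\<^esub> x) = inv\<^bsub>H j\<^esub> \<phi> j x" if "x \<in> carrier G" for j x
    using that by (rule group_hom.hom_inv[OF hom])
  have grp: "group (H j)" for j using hom by (simp add: group_hom_def)
  have mon: "monoid (H j)" for j using grp by (simp add: group.is_monoid)
  have c: "\<phi> j x \<in> carrier (H j)" if "x \<in> carrier G" for j x
    using that by (rule group_hom.hom_closed[OF hom])
  have conj1: "\<phi> j (x \<otimes>\<^bsub>G\<^esub> y \<otimes>\<^bsub>G\<^esub> inv\<^bsub>G\<^esub> x) = \<one>\<^bsub>H j\<^esub>"
    if "x \<in> carrier G" "y \<in> carrier G" "\<phi> j y = \<one>\<^bsub>H j\<^esub>" for j x y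
    using that by (simp add: m i c monoid.r_one[OF mon] group.r_inv[OF grp])
  show ?thesis
    unfolding G.normal_inv_iff
  proof (intro conjI ballI)
    show "subgroup (omega_kernel \<omega> G H \<phi>) G"
    proof (rule G.subgroupI)
      show "omega_kernel \<omega> G H \<phi> \<noteq> {}"
        using one almost_surely_True[OF \<omega>] by (force simp: omega_kernel_def)
    next
      fix x assume "x \<in> omega_kernel \<omega> G H \<phi>"
      then show "inv\<^bsub>G\<^esub> x \<in> omega_kernel \<omega> G H \<phi>"
        by (auto simp: omega_kernel_def i monoid.inv_one[OF mon] elim: almost_surely_mono[OF \<omega>])
    next
      fix x y assume "x \<in> omega_kernel \<omega> G H \<phi>" "y \<in> omega_kernel \<omega> G H \<phi>"
      then have xy: "x \<in> carrier G" "y \<in> carrier G"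
        "almost_surely \<omega> (\<lambda>j. \<phi> j x = \<one>\<^bsub>H j\<^esub> \<and> \<phi> j y = \<one>\<^bsub>H j\<^esub>)"
        by (auto simp: omega_kernel_def intro: almost_surely_conj[OF \<omega>])
      have "almost_surely \<omega> (\<lambda>j. \<phi> j (x \<otimes>\<^bsub>G\<^esub> y) = \<one>\<^bsub>H j\<^esub>)"
        using xy(3) by (rule almost_surely_mono[OF \<omega>]) (simp add: m xy monoid.l_one[OF mon] monoid.one_closed[OF mon])
      with xy show "x \<otimes>\<^bsub>G\<^esub> y \<in> omega_kernel \<omega> G H \<phi>"
        by (simp add: omega_kernel_def)
    qed (auto simp: omega_kernel_def)
  next
    fix x y assume "x \<in> carrier G" "y \<in> omega_kernel \<omega> G H \<phi>"
    then show "x \<otimes>\<^bsub>G\<^esub> y \<otimes>\<^bsub>G\<^esub> inv\<^bsub>G\<^esub> x \<in> omega_kernel \<omega> G H \<phi>"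
      by (auto simp: omega_kernel_def conj1 elim: almost_surely_mono[OF \<omega>])
  qed
qed

text \<open>Replaces the isomorphism between \<open>L\<close> and a quotient of \<open>G\<close> by
  a surjection \<open>f\<close> from \<open>G\<close> onto \<open>L\<close> whose kernel is the
  omega-kernel. Elements of \<open>L\<close> can then be handled through lifts to \<open>G\<close>
  instead of cosets.\<close>

lemma limit_groupE:
  fixes \<G> :: "('a, 'm) monoid_scheme set" and L :: "('c, 'l) monoid_scheme"
  assumes \<omega>: "ultrafilter \<omega>" and grp: "\<forall>H\<in>\<G>. group H" and "limit_group TYPE('b) \<omega> \<G> L"
  obtains G :: "'b monoid" and H \<phi> f where
    "finitely_generated G" "\<And>j. H j \<in> \<G>" "\<And>j. group_hom G (H j) (\<phi> j)"
    "group_hom G L f" "f ` carrier G = carrier L" "kernel G L f = omega_kernel \<omega> G H \<phi>"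
proof -
  from assms(3) obtain G :: "'b monoid" and H \<phi> where L: "group L" and G: "group G"
    and fg: "finitely_generated G" and H: "\<And>j. H j \<in> \<G>" and hom: "\<And>j. \<phi> j \<in> hom G (H j)"
    and iso: "L \<cong> G Mod omega_kernel \<omega> G H \<phi>"
    unfolding limit_group_def by metis
  let ?K = "omega_kernel \<omega> G H \<phi>"
  have \<phi>: "group_hom G (H j) (\<phi> j)" for j
    using G H grp hom by (simp add: group_hom_def group_hom_axioms_def)
  interpret K: normal ?K G
    by (rule omega_kernel_normal[OF \<omega> G \<phi>])
  interpret L: group L by (rule L)
  interpret Q: group "G Mod ?K" by (rule K.factorgroup_is_group)
  have "G Mod ?K \<cong> L" using L.iso_sym[OF iso] .
  then obtain h where h: "h \<in> iso (G Mod ?K) L" by (auto simp: is_iso_def)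
  interpret h: group_hom "G Mod ?K" L h
    using h L by (simp add: group_hom_def group_hom_axioms_def iso_def K.factorgroup_is_group)
  define f where "f = h \<circ> (\<lambda>x. ?K #>\<^bsub>G\<^esub> x)"
  have f: "f \<in> hom G L"
    unfolding f_def by (rule hom_compose[OF K.r_coset_hom_Mod h.homh])
  have onto: "f ` carrier G = carrier L"
    using h by (auto simp: f_def iso_def bij_betw_def FactGroup_def RCOSETS_def image_comp[symmetric])
  have inj: "inj_on h (carrier (G Mod ?K))" using h by (simp add: iso_def bij_betw_def)
  have "x \<in> kernel G L f \<longleftrightarrow> x \<in> ?K" for x
  proof (cases "x \<in> carrier G")
    case True
    \<comment> \<open>Injectivity of \<open>h\<close> reduces triviality of \<open>f x\<close> to
      triviality of the coset of \<open>x\<close>.\<close>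
    have "f x = \<one>\<^bsub>L\<^esub> \<longleftrightarrow> h (?K #>\<^bsub>G\<^esub> x) = h \<one>\<^bsub>G Mod ?K\<^esub>"
      unfolding f_def h.hom_one by simp
    also have "\<dots> \<longleftrightarrow> ?K #>\<^bsub>G\<^esub> x = ?K"
      using inj_on_eq_iff[OF inj, of "?K #>\<^bsub>G\<^esub> x" "\<one>\<^bsub>G Mod ?K\<^esub>"] True Q.one_closed
        hom_in_carrier[OF K.r_coset_hom_Mod] by (simp add: FactGroup_def)
    also have "\<dots> \<longleftrightarrow> x \<in> ?K"
      using True K.coset_join1 K.coset_join2 K.is_subgroup by blast
    finally show ?thesis using True by (simp add: kernel_def)
  next
    case False
    then show ?thesis unfolding kernel_def omega_kernel_def by blast
  qed
  then have "kernel G L f = ?K" by blast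
  then show ?thesis
    using that[OF fg H \<phi> _ onto] f G L by (simp add: group_hom_def group_hom_axioms_def)
qed

section \<open>Evaluation of words and finite generation\<close>

text \<open>Applied to both \<open>f\<close> and \<open>\<phi> j\<close>, this compares the value of
  a word at a tuple in \<open>G\<close> with its values at the images of the tuple in
  \<open>L\<close> and in \<open>H j\<close>.\<close>

lemma (in group_hom) eval_word_image:
  assumes "g \<in> X \<rightarrow> carrier G" "fst ` set w \<subseteq> X"
  shows "eval_word H (\<lambda>x. h (g x)) w = h (eval_word G g w)"
  using assms(2)
proof (induction w)
  case (Cons a w)
  then have "g (fst a) \<in> carrier G" "eval_word G g w \<in> carrier G"
    using assms(1) G.eval_word_closed[OF assms(1)] by auto
  then show ?case using Cons by simp
qed simp

lemma eval_word_cong: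
  assumes "\<And>x. x \<in> fst ` set w \<Longrightarrow> g x = g' x"
  shows "eval_word G g w = eval_word G g' w"
  using assms by (induction w) auto

text \<open>The image of the evaluation homomorphism is a subgroup containing the generators, which
  gives one inclusion. For the other, the value of a word is a product of generators and their
  inverses.\<close>

lemma (in group) generate_eq_eval_words:
  assumes "g \<in> X \<rightarrow> carrier G"
  shows "generate G (g ` X) = eval_word G g ` carrier (free_group X)"
proof
  interpret F: group "free_group X" by (rule group_free_group)
  interpret e: group_hom "free_group X" G "eval_word G g"
    using eval_word_hom[OF assms] by unfold_locales
  have "g x \<in> eval_word G g ` carrier (free_group X)" if "x \<in> X" for x
    using eval_word_free_gen[OF assms that] free_gen_closed[OF that] by (metis imageI)
  then show "generate G (g ` X) \<subseteq> eval_word G g ` carrier (free_group X)"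
    using e.img_is_subgroup by (intro generate_subgroup_incl) auto
  have "eval_word G g w \<in> generate G (g ` X)" if "fst ` set w \<subseteq> X" for w
    using that
  proof (induction w)
    case (Cons a w)
    then show ?case by (auto intro: generate.intros)
  qed (simp add: generate.one)
  then show "eval_word G g ` carrier (free_group X) \<subseteq> generate G (g ` X)"
    by (auto simp: free_group_def)
qed

text \<open>Writes the elements of \<open>G\<close> as values of words in the same free groups that
  the equations come from, so that relations among the generators form a system of
  equations.\<close>

lemma finitely_generatedE:
  assumes "group G" "finitely_generated G"
  obtains n :: nat and a where "n \<ge> 1" "a \<in> {1..n} \<rightarrow> carrier G"
    "carrier G = eval_word G a ` carrier (free_group {1..n})"
proof -
  interpret G: group G by fact
  obtain A where A: "A \<subseteq> carrier G" "finite A" "generate G A = carrier G"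
    using assms(2) by (auto simp: finitely_generated_def)
  \<comment> \<open>adjoining the identity ensures that the number of generators is positive\<close>
  define B where "B = insert \<one>\<^bsub>G\<^esub> A"
  have B: "B \<subseteq> carrier G" "finite B" "B \<noteq> {}" using A by (auto simp: B_def)
  have gen: "generate G B = carrier G"
    using A(3) G.mono_generate[of A B] G.generate_incl[OF B(1)] by (auto simp: B_def)
  obtain a where a: "bij_betw a {1..card B} B"
    using ex_bij_betw_nat_finite_1[OF B(2)] by blast
  then have im: "a ` {1..card B} = B" by (simp add: bij_betw_def)
  then have aP: "a \<in> {1..card B} \<rightarrow> carrier G" using B(1) by blast
  have "card B \<ge> 1" using B(2,3) by (simp add: Suc_leI card_gt_0_iff)
  then show ?thesis
    using that[OF _ aP] G.generate_eq_eval_words[OF aP] im gen by simp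
qed

section \<open>Almost sure solutions of systems of equations\<close>

text \<open>Tuples in a solution set are \<open>undefined\<close> outside \<open>{1..n}\<close>, and
  values there do not affect a word over \<open>{1..n}\<close>. This admits arbitrary functions as
  tuples and replaces \<open>subst_val\<close> by the recursive \<open>eval_word\<close>.\<close>

lemma (in group) restrict_in_solution_set_iff:
  assumes "g \<in> {1..n} \<rightarrow> carrier G" "S \<subseteq> carrier (free_group {1..n})"
  shows "restrict g {1..n} \<in> solution_set G n S \<longleftrightarrow> (\<forall>s\<in>S. eval_word G g s = \<one>)"
proof -
  have "subst_val G n (restrict g {1..n}) s = eval_word G g s" if "s \<in> S" for s
  proof -
    have s: "s \<in> carrier (free_group {1..n})" using that assms(2) by blast
    have "subst_val G n (restrict g {1..n}) s = eval_word G (restrict g {1..n}) s"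
      using assms(1) s by (intro subst_val_eq_eval_word) auto
    also have "\<dots> = eval_word G g s"
      using s by (intro eval_word_cong) (auto simp: free_group_def)
    finally show ?thesis .
  qed
  moreover have "restrict g {1..n} \<in> {1..n} \<rightarrow>\<^sub>E carrier G" using assms(1) by auto
  ultimately show ?thesis by (simp add: solution_set_def)
qed

text \<open>The groups \<open>H j\<close> and the tuples \<open>g j\<close> vary with
  \<open>j\<close>, but a single finite \<open>S0\<close> serves all of them. This is where it
  matters that the choice of \<open>S0\<close> is uniform over the family.\<close>

lemma almost_surely_solution:
  assumes \<omega>: "ultrafilter \<omega>" and grp: "\<And>j. group (H j)"
    and S: "S \<subseteq> carrier (free_group {1..n})" and S0: "S0 \<subseteq> S" "finite S0"
    and sol: "\<And>j. solution_set (H j) n S0 = solution_set (H j) n S"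
    and g: "\<And>j. g j \<in> {1..n} \<rightarrow> carrier (H j)"
    and as: "\<And>s. s \<in> S0 \<Longrightarrow> almost_surely \<omega> (\<lambda>j. eval_word (H j) (g j) s = \<one>\<^bsub>H j\<^esub>)"
  shows "almost_surely \<omega> (\<lambda>j. \<forall>s\<in>S. eval_word (H j) (g j) s = \<one>\<^bsub>H j\<^esub>)"
proof (rule almost_surely_mono[OF \<omega>])
  show "almost_surely \<omega> (\<lambda>j. \<forall>s\<in>S0. eval_word (H j) (g j) s = \<one>\<^bsub>H j\<^esub>)"
    using as by (rule almost_surely_finite_Ball[OF \<omega> S0(2)])
  \<comment> \<open>The restriction of \<open>g j\<close> lies in the solution set of
    \<open>S0\<close> in \<open>H j\<close>, which equals that of \<open>S\<close>.\<close>
  show "\<forall>s\<in>S. eval_word (H j) (g j) s = \<one>\<^bsub>H j\<^esub>"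
    if "\<forall>s\<in>S0. eval_word (H j) (g j) s = \<one>\<^bsub>H j\<^esub>" for j
    using that sol[of j] group.restrict_in_solution_set_iff[OF grp g S]
      group.restrict_in_solution_set_iff[OF grp g order_trans[OF S0(1) S]] by metis
qed

section \<open>Limit groups are equationally Noetherian\<close>

lemma limit_group_equationally_noetherian:
  assumes \<omega>: "ultrafilter \<omega>" and \<G>: "equationally_noetherian_family \<G>"
    and L: "limit_group TYPE('b) \<omega> \<G> L"
  shows "equationally_noetherian L"
proof -
  have grp: "\<forall>H\<in>\<G>. group H" using \<G> by (simp add: equationally_noetherian_family_def)
  obtain G :: "'b monoid" and H \<phi> f where H: "\<And>j. H j \<in> \<G>"
    and \<phi>: "\<And>j. group_hom G (H j) (\<phi> j)" and f: "group_hom G L f"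
    and onto: "f ` carrier G = carrier L" and ker: "kernel G L f = omega_kernel \<omega> G H \<phi>"
    using limit_groupE[OF \<omega> grp L] by metis
  interpret f: group_hom G L f by (rule f)
  have "\<exists>S0\<subseteq>S. finite S0 \<and> solution_set L n S0 = solution_set L n S"
    if n: "n \<ge> 1" and S: "S \<subseteq> carrier (free_group {1..n})" for n S
  proof -
    obtain S0 where S0: "S0 \<subseteq> S" "finite S0"
      and sol: "\<And>K. K \<in> \<G> \<Longrightarrow> solution_set K n S0 = solution_set K n S"
      using \<G> n S unfolding equationally_noetherian_family_def by metis
    have "l \<in> solution_set L n S" if l: "l \<in> solution_set L n S0" for l
    proof -
      \<comment> \<open>A lift of the tuple \<open>l\<close> to \<open>G\<close>, chosen coordinate
        by coordinate. Outside \<open>{1..n}\<close> the choice is arbitrary; only indices in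
        \<open>{1..n}\<close> enter below.\<close>
      define g where "g i = (SOME x. x \<in> carrier G \<and> f x = l i)" for i
      have lE: "l \<in> {1..n} \<rightarrow>\<^sub>E carrier L" using l by (simp add: solution_set_def)
      have gi: "g i \<in> carrier G \<and> f (g i) = l i" if "i \<in> {1..n}" for i
      proof -
        have "l i \<in> f ` carrier G" using lE that onto by blast
        then have "\<exists>x. x \<in> carrier G \<and> f x = l i" by auto
        then show ?thesis unfolding g_def by (rule someI_ex)
      qed
      have g: "g \<in> {1..n} \<rightarrow> carrier G" using gi by blast
      have fg: "(\<lambda>i. f (g i)) \<in> {1..n} \<rightarrow> carrier L" using g f.hom_closed by blast
      have \<phi>g: "(\<lambda>i. \<phi> j (g i)) \<in> {1..n} \<rightarrow> carrier (H j)" for j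
        using g by (intro funcsetI group_hom.hom_closed[OF \<phi>]) (rule funcset_mem)
      \<comment> \<open>Tuples are extensional on \<open>{1..n}\<close>, so \<open>l\<close> is
        identified with the image of its lift only after restriction.\<close>
      have l_eq: "l = restrict (\<lambda>i. f (g i)) {1..n}"
        using gi lE by (intro extensionalityI[of _ "{1..n}"]) (auto simp: PiE_def)
      \<comment> \<open>The kernel of \<open>f\<close> is the omega-kernel, so an equation holds at
        the tuple in \<open>L\<close> exactly when it holds almost surely at the images of the lift
        in the groups \<open>H j\<close>.\<close>
      have key: "eval_word L (\<lambda>i. f (g i)) s = \<one>\<^bsub>L\<^esub> \<longleftrightarrow>
          almost_surely \<omega> (\<lambda>j. eval_word (H j) (\<lambda>i. \<phi> j (g i)) s = \<one>\<^bsub>H j\<^esub>)" if "s \<in> S" for s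
      proof -
        have s: "fst ` set s \<subseteq> {1..n}" using that S by (auto simp: free_group_def)
        have "eval_word L (\<lambda>i. f (g i)) s = \<one>\<^bsub>L\<^esub> \<longleftrightarrow> eval_word G g s \<in> kernel G L f"
          using f.eval_word_image[OF g s] f.G.eval_word_closed[OF g s] by (simp add: kernel_def)
        also have "\<dots> \<longleftrightarrow> almost_surely \<omega> (\<lambda>j. \<phi> j (eval_word G g s) = \<one>\<^bsub>H j\<^esub>)"
          using f.G.eval_word_closed[OF g s] by (simp add: ker omega_kernel_def)
        finally show ?thesis by (simp add: group_hom.eval_word_image[OF \<phi> g s])
      qed
      \<comment> \<open>From here \<open>key\<close> is used in both directions: from
        \<open>L\<close> to the groups \<open>H j\<close> for the equations of \<open>S0\<close>,
        and back to \<open>L\<close> for those of \<open>S\<close>.\<close>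
      have "\<forall>s\<in>S0. eval_word L (\<lambda>i. f (g i)) s = \<one>\<^bsub>L\<^esub>"
        using l f.H.restrict_in_solution_set_iff[OF fg order_trans[OF S0(1) S]]
        by (simp add: l_eq)
      then have "almost_surely \<omega> (\<lambda>j. \<forall>s\<in>S. eval_word (H j) (\<lambda>i. \<phi> j (g i)) s = \<one>\<^bsub>H j\<^esub>)"
        using key S0(1) grp H by (intro almost_surely_solution[OF \<omega> _ S S0 sol[OF H] \<phi>g]) auto
      then have "\<forall>s\<in>S. eval_word L (\<lambda>i. f (g i)) s = \<one>\<^bsub>L\<^esub>"
        using key by (auto elim: almost_surely_mono[OF \<omega>])
      then show ?thesis
        using f.H.restrict_in_solution_set_iff[OF fg S] by (simp add: l_eq)
    qed
    \<comment> \<open>The other inclusion is immediate: a solution of \<open>S\<close> solves its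
      subset \<open>S0\<close>.\<close>
    then have "solution_set L n S0 = solution_set L n S"
      using S0(1) by (auto simp: solution_set_def)
    with S0 show ?thesis by blast
  qed
  then show ?thesis using f.H.is_group by (simp add: equationally_noetherian_def)
qed

section \<open>Factorization through \<open>L\<close> and residual finiteness\<close>

text \<open>The quotient injects into \<open>H\<close>: \<open>h\<close> is constant on each coset
  of its kernel, and distinct cosets have distinct values.\<close>

lemma (in group_hom) finite_carrier_FactGroup_kernel:
  assumes "finite (carrier H)"
  shows "finite (carrier (G Mod kernel G H h))"
proof (rule finite_imageD)
  show "finite ((\<lambda>X. the_elem (h ` X)) ` carrier (G Mod kernel G H h))"
    using hom_in_carrier[OF FactGroup_hom] by (auto intro: finite_subset[OF _ assms])
qed (rule FactGroup_inj_on)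

text \<open>If \<open>f x = f y\<close>, then \<open>x\<close> and \<open>y\<close> differ by an
  element of the kernel of \<open>f\<close>, on which \<open>\<phi>\<close> is trivial. So
  \<open>\<phi> x\<close> depends only on \<open>f x\<close>, and \<open>\<psi>\<close> can be
  computed from any preimage.\<close>

lemma group_hom_factor_through:
  assumes f: "group_hom G L f" and onto: "f ` carrier G = carrier L"
    and \<phi>: "group_hom G H \<phi>" and ker: "kernel G L f \<subseteq> kernel G H \<phi>"
  obtains \<psi> where "group_hom L H \<psi>" "\<And>x. x \<in> carrier G \<Longrightarrow> \<psi> (f x) = \<phi> x"
proof -
  interpret f: group_hom G L f by (rule f)
  interpret \<phi>: group_hom G H \<phi> by (rule \<phi>)
  have eq: "\<phi> x = \<phi> y" if "x \<in> carrier G" "y \<in> carrier G" "f x = f y" for x y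
  proof -
    have "x \<otimes>\<^bsub>G\<^esub> inv\<^bsub>G\<^esub> y \<in> kernel G L f" using that by (simp add: kernel_def)
    then have "\<phi> (x \<otimes>\<^bsub>G\<^esub> inv\<^bsub>G\<^esub> y) = \<one>\<^bsub>H\<^esub>" using ker by (auto simp: kernel_def)
    then have "\<phi> x \<otimes>\<^bsub>H\<^esub> inv\<^bsub>H\<^esub> \<phi> y = \<one>\<^bsub>H\<^esub>" using that by simp
    then show ?thesis using that by (metis \<phi>.H.inv_equality \<phi>.H.inv_inv \<phi>.H.inv_closed \<phi>.hom_closed)
  qed
  define \<psi> where "\<psi> l = \<phi> (inv_into (carrier G) f l)" for l
  have \<psi>: "\<psi> (f x) = \<phi> x" if "x \<in> carrier G" for x
    unfolding \<psi>_def using that by (intro eq) (auto intro: inv_into_into f_inv_into_f)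
  have "\<psi> \<in> hom L H"
  proof (rule homI)
    fix l assume "l \<in> carrier L"
    then obtain x where "x \<in> carrier G" "l = f x" using onto by blast
    then show "\<psi> l \<in> carrier H" by (simp add: \<psi>)
  next
    fix l m assume "l \<in> carrier L" "m \<in> carrier L"
    then obtain x y where xy: "x \<in> carrier G" "l = f x" "y \<in> carrier G" "m = f y"
      using onto by blast
    then have "\<psi> (f (x \<otimes>\<^bsub>G\<^esub> y)) = \<phi> x \<otimes>\<^bsub>H\<^esub> \<phi> y"
      by (subst \<psi>) auto
    then show "\<psi> (l \<otimes>\<^bsub>L\<^esub> m) = \<psi> l \<otimes>\<^bsub>H\<^esub> \<psi> m" using xy by (simp add: \<psi>)
  qed
  then have "group_hom L H \<psi>" by unfold_locales
  then show ?thesis using \<psi> that by blast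
qed

lemma limit_group_residually_finite:
  assumes \<omega>: "ultrafilter \<omega>" and \<G>: "equationally_noetherian_family \<G>"
    and L: "limit_group TYPE('b) \<omega> \<G> L" and fin: "\<forall>H\<in>\<G>. finite (carrier H)"
  shows "residually_finite L"
proof -
  have grp: "\<forall>H\<in>\<G>. group H" using \<G> by (simp add: equationally_noetherian_family_def)
  obtain G :: "'b monoid" and H \<phi> f where fg: "finitely_generated G" and H: "\<And>j. H j \<in> \<G>"
    and \<phi>: "\<And>j. group_hom G (H j) (\<phi> j)" and f: "group_hom G L f"
    and onto: "f ` carrier G = carrier L" and ker: "kernel G L f = omega_kernel \<omega> G H \<phi>"
    using limit_groupE[OF \<omega> grp L] by metis
  interpret f: group_hom G L f by (rule f)
  obtain n :: nat and a where n: "n \<ge> 1" and a: "a \<in> {1..n} \<rightarrow> carrier G"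
    and car: "carrier G = eval_word G a ` carrier (free_group {1..n})"
    using finitely_generatedE[OF f.G.is_group fg] by blast
  have \<phi>_eval: "\<phi> j (eval_word G a s) = eval_word (H j) (\<lambda>i. \<phi> j (a i)) s"
    if "s \<in> carrier (free_group {1..n})" for j s
    using that group_hom.eval_word_image[OF \<phi> a] by (simp add: free_group_def)
  \<comment> \<open>The possibly infinite system of all relations that the elements
    \<open>f (a i)\<close> satisfy in \<open>L\<close>, expressed in \<open>G\<close> through the
    kernel of \<open>f\<close>.\<close>
  define S where "S = {s \<in> carrier (free_group {1..n}). eval_word G a s \<in> kernel G L f}"
  have S: "S \<subseteq> carrier (free_group {1..n})" by (auto simp: S_def)
  obtain S0 where S0: "S0 \<subseteq> S" "finite S0"
    and sol: "\<And>K. K \<in> \<G> \<Longrightarrow> solution_set K n S0 = solution_set K n S"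
    using \<G> n S unfolding equationally_noetherian_family_def by metis
  have \<phi>a: "(\<lambda>i. \<phi> j (a i)) \<in> {1..n} \<rightarrow> carrier (H j)" for j
    using a by (intro funcsetI group_hom.hom_closed[OF \<phi>]) (rule funcset_mem)
  have "almost_surely \<omega> (\<lambda>j. \<forall>s\<in>S. eval_word (H j) (\<lambda>i. \<phi> j (a i)) s = \<one>\<^bsub>H j\<^esub>)"
  proof (rule almost_surely_solution[OF \<omega> _ S S0 sol[OF H] \<phi>a])
    fix s assume "s \<in> S0"
    then have "s \<in> S" using S0(1) by blast
    then have s: "s \<in> carrier (free_group {1..n})" "eval_word G a s \<in> omega_kernel \<omega> G H \<phi>"
      by (simp_all add: S_def ker)
    show "almost_surely \<omega> (\<lambda>j. eval_word (H j) (\<lambda>i. \<phi> j (a i)) s = \<one>\<^bsub>H j\<^esub>)"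
      using s(2) by (simp add: omega_kernel_def \<phi>_eval[OF s(1)])
  qed (use grp H in blast)
  \<comment> \<open>Since the \<open>a i\<close> generate \<open>G\<close>, every element of the
    kernel of \<open>f\<close> is the value of a word in \<open>S\<close>. An index \<open>j\<close>
    at which all of \<open>S\<close> holds therefore makes \<open>\<phi> j\<close> trivial on the
    whole kernel.\<close>
  then have factor: "almost_surely \<omega> (\<lambda>j. kernel G L f \<subseteq> kernel G (H j) (\<phi> j))"
  proof (rule almost_surely_mono[OF \<omega>], intro subsetI)
    fix j x
    assume j: "\<forall>s\<in>S. eval_word (H j) (\<lambda>i. \<phi> j (a i)) s = \<one>\<^bsub>H j\<^esub>" and x: "x \<in> kernel G L f"
    then have xG: "x \<in> carrier G" by (simp add: kernel_def)
    then obtain s where s: "s \<in> carrier (free_group {1..n})" "x = eval_word G a s" using car by blast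
    then have "\<phi> j x = \<one>\<^bsub>H j\<^esub>" using j x by (simp add: S_def \<phi>_eval)
    then show "x \<in> kernel G (H j) (\<phi> j)" using xG by (simp add: kernel_def)
  qed
  have "\<exists>N. N \<lhd> L \<and> finite (carrier (L Mod N)) \<and> l \<notin> N"
    if l: "l \<in> carrier L" "l \<noteq> \<one>\<^bsub>L\<^esub>" for l
  proof -
    obtain x where x: "x \<in> carrier G" "l = f x" using onto l(1) by blast
    then have "x \<notin> omega_kernel \<omega> G H \<phi>" using l(2) ker by (auto simp: kernel_def)
    then have "almost_surely \<omega> (\<lambda>j. \<phi> j x \<noteq> \<one>\<^bsub>H j\<^esub>)"
      using x(1) almost_surely_not[OF \<omega>] by (simp add: omega_kernel_def)
    \<comment> \<open>Two almost sure properties share an index \<open>j\<close>: there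
      \<open>x\<close> has a nontrivial image, and \<open>\<phi> j\<close> factors through
      \<open>L\<close>.\<close>
    then obtain j where j: "\<phi> j x \<noteq> \<one>\<^bsub>H j\<^esub>" "kernel G L f \<subseteq> kernel G (H j) (\<phi> j)"
      using almost_surely_imp_ex[OF \<omega> almost_surely_conj[OF \<omega> _ factor]] by blast
    obtain \<psi> where \<psi>: "group_hom L (H j) \<psi>" "\<And>x. x \<in> carrier G \<Longrightarrow> \<psi> (f x) = \<phi> j x"
      using group_hom_factor_through[OF f onto \<phi> j(2)] by blast
    \<comment> \<open>The kernel of \<open>\<psi>\<close> is the normal subgroup sought:
      \<open>\<psi> l\<close> equals \<open>\<phi> j x\<close> and is nontrivial, and the quotient
      by the kernel embeds in the finite group \<open>H j\<close>.\<close>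
    have "l \<notin> kernel L (H j) \<psi>" using \<psi>(2) x j(1) by (simp add: kernel_def)
    moreover have "finite (carrier (H j))" using fin H by blast
    ultimately show ?thesis
      using group_hom.normal_kernel[OF \<psi>(1)] group_hom.finite_carrier_FactGroup_kernel[OF \<psi>(1)]
      by blast
  qed
  then show ?thesis using f.H.is_group by (simp add: residually_finite_def)
qed

theorem proposition1p4:
  fixes \<omega> :: "nat set \<Rightarrow> real" and \<G> :: "'a monoid set" and L :: "'c monoid"
  assumes "nonprincipal_ultrafilter \<omega>"
    and "equationally_noetherian_family \<G>"
    and "limit_group TYPE('b) \<omega> \<G> L"
  shows "equationally_noetherian L \<and>
    ((\<forall>H\<in>\<G>. finite (carrier H)) \<longrightarrow> residually_finite L)"
proof -
  have "ultrafilter \<omega>" using assms(1) by (simp add: nonprincipal_ultrafilter_def)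
  then show ?thesis
    using limit_group_equationally_noetherian[OF _ assms(2,3)]
      limit_group_residually_finite[OF _ assms(2,3)] by blast
qed

end
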